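(* Let $m\ge 5$. Let $\Gamma$ be a graph with a vertex partition $\{C_1,\dots,C_m,D\}$, where the indices of the sets $C_i$ are read in $\mathbb{Z}/m\mathbb{Z}$, such that: (i) $|C_1|=\cdots=|C_m|=2$; write $C_i=\{v_{i1},v_{i2}\}$. (ii) For every vertex $v\in D$, the numbers of neighbours of $v$ in $C_1,\dots,C_m$ are all congruent modulo $2$. (iii) For all $i,j\in\mathbb{Z}/m\mathbb{Z}$ with $j\in\{i+1,\dots,i+\lfloor\frac{m}{2}\rfloor\}$, the edge set of the induced subgraph on $C_i\cup C_j$ is: - either $\{v_{i1}v_{j1},\,v_{i1}v_{j2}\}$ or $\{v_{i2}v_{j1},\,v_{i2}v_{j2}\}$, if $j=i+1$; - either $\{v_{i1}v_{j1},\,v_{i2}v_{j1}\}$ or $\{v_{i1}v_{j2},\,v_{i2}v_{j2}\}$, if $j=i+2$; - either empty or $\{v_{i1}v_{j1},v_{i1}v_{j2},v_{i2}v_{j1},v_{i2}v_{j2}\}$, if $j\in\{i+3,\dots,i+\lfloor\frac m2\rfloor\}$. Let $\pi$ be the permutation of $C_1\cup\dots\cup C_m$ with $\pi(v_{ia})=v_{i-1,a}$ for all $i\in\mathbb{Z}/m\mathbb{Z}$ and $a\in\{1,2\}$. Construct a graph $\Gamma'$ from $\Gamma$ on the same vertex set as follows, leaving all other adjacencies unchanged. - For every $v\in D$ that has exactly one neighbour $w$ in each $C_i$, replace each such edge $\{v,w\}$ by $\{v,\pi(w)\}$. - For all $i\in\mathbb{Z}/m\mathbb{Z}$, simultaneously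 replace the induced subgraph on $C_i\cup C_{i+1}$ by the former induced subgraph on $C_i\cup C_{i+2}$, and replace the induced subgraph on $C_i\cup C_{i+2}$ by the former induced subgraph on $C_{i+1}\cup C_{i+2}$. Then $\Gamma'$ is $\mathbb{R}$-cospectral with $\Gamma$.
   Context: Graphs are finite, simple and loopless. Two graphs with adjacency matrices $A$ and $A'$ are $\mathbb{R}$-cospectral if $A+rJ$ and $A'+rJ$ have the same spectrum for every $r\in\mathbb{R}$, where $J$ is the all-ones matrix. "Replace the induced subgraph on $C_i\cup C_j$ by the former induced subgraph on $C_k\cup C_l$" means: in the new graph, $v_{ia}$ and $v_{jb}$ are adjacent if and only if $v_{ka}$ and $v_{lb}$ were adjacent in $\Gamma$ ($a,b\in\{1,2\}$); the sets $C_i$ themselves remain edgeless. *)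

theory Defs
  imports
    "HOL-Analysis.Analysis"
    "HOL-Number_Theory.Cong"
    "HOL-Computational_Algebra.Polynomial"
begin

text \<open>A graph is given by its set of edges, each an unordered pair of distinct vertices. The
  vertex set is the whole (finite) type.\<close>

definition simple_graph :: "'v set set \<Rightarrow> bool" where
  "simple_graph E \<longleftrightarrow> (\<forall>e\<in>E. card e = 2)"

definition induced_edges :: "'v set set \<Rightarrow> 'v set \<Rightarrow> 'v set set" where
  "induced_edges E S = {e \<in> E. e \<subseteq> S}"

definition nbrs_in :: "'v set set \<Rightarrow> 'v \<Rightarrow> 'v set \<Rightarrow> 'v set" where
  "nbrs_in E x S = {w \<in> S. {x, w} \<in> E}"

definition adj_matrix :: "'v::finite set set \<Rightarrow> real^'v^'v" where
  "adj_matrix E = (\<chi> x y. if {x, y} \<in> E then 1 else 0)"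

definition all_ones :: "real^'v^'v" where
  "all_ones = (\<chi> x y. 1)"

definition charpoly :: "'a::comm_ring_1^'v^'v \<Rightarrow> 'a poly" where
  "charpoly M = det (\<chi> x y. (if x = y then [:0, 1:] else 0) - [:M $ x $ y:])"

text \<open>The multiset of complex eigenvalues, counted with algebraic multiplicity.\<close>

definition spectrum :: "real^'v^'v \<Rightarrow> complex multiset" where
  "spectrum M = proots (charpoly (\<chi> x y. complex_of_real (M $ x $ y)))"

definition R_cospectral :: "'v::finite set set \<Rightarrow> 'v set set \<Rightarrow> bool" where
  "R_cospectral E E' \<longleftrightarrow>
     (\<forall>r::real. spectrum (adj_matrix E + r *\<^sub>R all_ones) = spectrum (adj_matrix E' + r *\<^sub>R all_ones))"

text \<open>Sequences indexed by the residues modulo \<open>m\<close> are \<open>m\<close>-periodic functions on the integers: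
  \<open>v i a\<close> (\<open>a \<in> {1, 2}\<close>) is the vertex \<open>v\<^sub>i\<^sub>a\<close> and \<open>C i\<close> is the cell \<open>{v i 1, v i 2}\<close>.
  In the switched graph all replaced edges are removed and all new edges are inserted
  simultaneously, both being read off from the original edge set \<open>E\<close>.\<close>

definition single_nbr :: "'v set set \<Rightarrow> (int \<Rightarrow> 'v set) \<Rightarrow> 'v set \<Rightarrow> 'v set" where
  "single_nbr E C D = {x \<in> D. \<forall>i. card (nbrs_in E x (C i)) = 1}"

definition removed_edges ::
    "'v set set \<Rightarrow> (int \<Rightarrow> 'v set) \<Rightarrow> 'v set \<Rightarrow> 'v set set" where
  "removed_edges E C D =
     {{x, w} | x w i. x \<in> single_nbr E C D \<and> w \<in> nbrs_in E x (C i)}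
     \<union> (\<Union>i. induced_edges E (C i \<union> C (i + 1)))
     \<union> (\<Union>i. induced_edges E (C i \<union> C (i + 2)))"

definition added_edges ::
    "'v set set \<Rightarrow> (int \<Rightarrow> nat \<Rightarrow> 'v) \<Rightarrow> (int \<Rightarrow> 'v set) \<Rightarrow> 'v set \<Rightarrow> ('v \<Rightarrow> 'v) \<Rightarrow> 'v set set" where
  "added_edges E v C D \<pi> =
     {{x, \<pi> w} | x w i. x \<in> single_nbr E C D \<and> w \<in> nbrs_in E x (C i)}
     \<union> {{v i a, v (i + 1) b} | i a b.
          a \<in> {1, 2} \<and> b \<in> {1, 2} \<and> {v i a, v (i + 2) b} \<in> E}
     \<union> {{v i a, v (i + 2) b} | i a b.
          a \<in> {1, 2} \<and> b \<in> {1, 2} \<and> {v (i + 1) a, v (i + 2) b} \<in> E}"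

definition switched_graph ::
    "'v set set \<Rightarrow> (int \<Rightarrow> nat \<Rightarrow> 'v) \<Rightarrow> (int \<Rightarrow> 'v set) \<Rightarrow> 'v set \<Rightarrow> ('v \<Rightarrow> 'v) \<Rightarrow> 'v set set" where
  "switched_graph E v C D \<pi> = (E - removed_edges E C D) \<union> added_edges E v C D \<pi>"

end

theory Submission
  imports Defs
begin

text \<open>On the \<open>2m\<close> vertices of the cells let \<open>S\<close> swap the two vertices of each cell and let \<open>T\<close>
  map \<open>v i a\<close> to \<open>v (i + 1) a\<close>; both fix \<open>D\<close>. With the complementary projections
  \<open>P = (1 + S) / 2\<close> and \<open>N = (1 - S) / 2\<close>, the matrix \<open>Q = P + N T\<close> is orthogonal with \<open>Q J = J\<close>.
  The \<open>(i, j)\<close> block of \<open>Q A Q\<^sup>T\<close> is \<open>P A(i,j) P + N A(i+1,j) P + P A(i,j+1) N + N A(i+1,j+1) N\<close>.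
  As \<open>N\<close> annihilates blocks with equal rows (from the left) or equal columns (from the right),
  the last term always vanishes and the others reduce to the switching rule; a vector on the cells
  that is constant on each cell is fixed by \<open>Q\<close>, and one with a single 1 in each cell is
  shifted. Hence \<open>Q\<close> conjugates \<open>A + r J\<close> into \<open>A' + r J\<close>.\<close>

section \<open>Spectra of similar matrices\<close>

lemma map_matrix_mult:
  assumes "h 0 = 0" "\<And>a b. h (a + b) = h a + h b" "\<And>a b. h (a * b) = h a * h b"
  shows "map_matrix h (A ** B) =
    map_matrix h (A :: 'a::semiring_1^'n^'m) ** (map_matrix h B :: 'b::semiring_1^'p^'n)"
proof -
  have "h (sum f S) = (\<Sum>x\<in>S. h (f x))" if "finite S" for f :: "'n \<Rightarrow> 'a" and S
    using that by induction (simp_all add: assms)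
  then show ?thesis
    by (simp add: map_matrix_def matrix_matrix_mult_def assms(3))
qed

text \<open>With entries embedded as constant polynomials, the conjugation takes place over the
  polynomial ring: the scalar matrix \<open>?X\<close> commutes with everything, so
  \<open>?X - ?c M\<close> is conjugated into \<open>?X - ?c (Q ** M ** Q')\<close>, and the
  determinant is multiplicative.\<close>

lemma charpoly_similar:
  fixes M Q Q' :: "'a::comm_ring_1^'n^'n"
  assumes "Q ** Q' = mat 1"
  shows "charpoly (Q ** M ** Q') = charpoly M"
proof -
  let ?c = "map_matrix (\<lambda>a::'a. [:a:]) :: 'a^'n^'n \<Rightarrow> 'a poly^'n^'n"
  let ?X = "mat [:0, 1:] :: 'a poly^'n^'n"
  have mult: "?c (A ** B) = ?c A ** ?c B" for A B
    by (rule map_matrix_mult) simp_all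
  have "?c (mat 1) = mat 1"
    by (simp add: map_matrix_def mat_def vec_eq_iff one_pCons)
  with mult assms have inv: "?c Q ** ?c Q' = mat 1"
    by metis
  have cp: "charpoly A = det (?X - ?c A)" for A
    unfolding charpoly_def
    by (rule arg_cong[where f = det]) (simp add: vec_eq_iff mat_def map_matrix_def)
  have X: "B ** ?X = ?X ** B" for B
    by (simp add: vec_eq_iff matrix_matrix_mult_def mat_def if_distrib if_distribR mult.commute
        cong: if_cong)
  have ldiff: "B ** (F - G) = B ** F - B ** G" and rdiff: "(F - G) ** B = F ** B - G ** B"
    for B F G :: "'a poly^'n^'n"
    by (simp_all add: vec_eq_iff matrix_matrix_mult_def right_diff_distrib left_diff_distrib
        sum_subtractf)
  have conj: "?c Q ** (?X - ?c M) ** ?c Q' = ?X - ?c (Q ** M ** Q')"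
  proof -
    have "?c Q ** ?X ** ?c Q' = ?X"
      by (simp add: X inv flip: matrix_mul_assoc)
    then show ?thesis
      by (simp add: ldiff rdiff mult)
  qed
  have "charpoly (Q ** M ** Q') = det (?c Q ** (?X - ?c M) ** ?c Q')"
    by (simp only: cp conj)
  also have "\<dots> = det (?c Q ** ?c Q') * det (?X - ?c M)"
    by (simp only: det_mul mult_ac)
  also have "\<dots> = charpoly M"
    by (simp add: inv cp)
  finally show ?thesis .
qed

lemma spectrum_similar:
  fixes M Q Q' :: "real^'n^'n"
  assumes "Q ** Q' = mat 1"
  shows "spectrum (Q ** M ** Q') = spectrum M"
proof -
  let ?c = "map_matrix complex_of_real :: real^'n^'n \<Rightarrow> complex^'n^'n"
  have mult: "?c (A ** B) = ?c A ** ?c B" for A B :: "real^'n^'n"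
    by (rule map_matrix_mult) simp_all
  have "?c Q ** ?c Q' = ?c (mat 1)"
    by (simp only: assms mult[symmetric])
  also have "\<dots> = mat 1"
    by (simp add: map_matrix_def mat_def vec_eq_iff)
  finally have "charpoly (?c (Q ** M ** Q')) = charpoly (?c M)"
    by (simp add: mult charpoly_similar)
  then show ?thesis
    by (simp add: spectrum_def map_matrix_def)
qed

section \<open>The matrix P + N T and its orthogonality\<close>

definition shift_op :: "('v \<Rightarrow> 'v) \<Rightarrow> ('v \<Rightarrow> 'v) \<Rightarrow> ('v \<Rightarrow> real) \<Rightarrow> 'v \<Rightarrow> real" where
  "shift_op s t f x = (f x + f (s x) + f (t x) - f (s (t x))) / 2"

text \<open>With T f = f o t and S f = f o s, \<open>shift_op s t\<close> is P + N T acting on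
  functions, provided that \<open>s\<close> and \<open>t\<close> commute. The columns of the matrix
  are the images of the unit vectors.\<close>

definition shift_matrix :: "('v \<Rightarrow> 'v) \<Rightarrow> ('v \<Rightarrow> 'v) \<Rightarrow> real^'v^'v" where
  "shift_matrix s t = (\<chi> x y. shift_op s t (\<lambda>z. of_bool (z = y)) x)"

lemma sum_shift_matrix:
  "(\<Sum>y\<in>UNIV. shift_matrix s t $ x $ y * f y) = shift_op s t f (x :: 'v::finite)"
proof -
  have delta: "(\<Sum>y\<in>UNIV. f y * of_bool (z = y)) = f z" for z
    by (simp add: of_bool_def if_distrib cong: if_cong)
  have "shift_matrix s t $ x $ y * f y =
      (f y * of_bool (x = y) + f y * of_bool (s x = y) + f y * of_bool (t x = y)
        - f y * of_bool (s (t x) = y)) / 2" for y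
    by (simp add: shift_matrix_def shift_op_def field_simps)
  then have "(\<Sum>y\<in>UNIV. shift_matrix s t $ x $ y * f y) = (\<Sum>y\<in>UNIV.
      (f y * of_bool (x = y) + f y * of_bool (s x = y) + f y * of_bool (t x = y)
        - f y * of_bool (s (t x) = y)) / 2)"
    by (simp only:)
  also have "\<dots> = shift_op s t f x"
    by (simp add: shift_op_def sum.distrib sum_subtractf delta flip: sum_divide_distrib)
  finally show ?thesis .
qed

text \<open>Replaces the double matrix product by one \<open>shift_op\<close> in each argument, so
  that an entry of the conjugate is a signed sum of 16 entries of \<open>M\<close>, divided by
  4.\<close>

lemma shift_matrix_conj:
  "(shift_matrix s t ** M ** transpose (shift_matrix s t)) $ x $ y =
    shift_op s t (\<lambda>k. shift_op s t (\<lambda>l. M $ l $ k) x) (y :: 'v::finite)"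
  by (simp add: matrix_matrix_mult_def transpose_def sum_shift_matrix
      mult.commute[of _ "shift_matrix s t $ y $ _"])

text \<open>The transpose of P + N T is P + T^-1 N, since \<open>t\<close> is a permutation and
  \<open>s\<close> an involution. As S and T commute and P N = 0, the mixed terms vanish and P + N =
  1 remains. The proof verifies this entry by entry.\<close>

lemma shift_matrix_orthogonal:
  fixes s t :: "'v::finite \<Rightarrow> 'v"
  assumes s: "\<And>x. s (s x) = x" and t: "inj t" and st: "\<And>x. t (s x) = s (t x)"
  shows "shift_matrix s t ** transpose (shift_matrix s t) = mat 1"
proof -
  have inj: "s x = s y \<longleftrightarrow> x = y" "t x = t y \<longleftrightarrow> x = y" for x y
    using s injD[OF t] by metis+
  have sw: "s x = y \<longleftrightarrow> x = s y" for x y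
    using s by metis
  have ts: "t x = s (t y) \<longleftrightarrow> x = s y" for x y
    using inj(2) st by metis
  have "(\<Sum>k\<in>UNIV. shift_matrix s t $ x $ k * shift_matrix s t $ y $ k) = of_bool (x = y)" for x y
    unfolding sum_shift_matrix
    by (auto simp: shift_matrix_def shift_op_def inj ts sw s)
  then show ?thesis
    by (simp add: matrix_matrix_mult_def transpose_def mat_def vec_eq_iff)
qed


section \<open>The cells and their periodic coordinates\<close>

locale switching =
  fixes m :: nat
    and E :: "'v::finite set set"
    and v :: "int \<Rightarrow> nat \<Rightarrow> 'v"
    and C :: "int \<Rightarrow> 'v set"
    and D :: "'v set"
    and \<pi> :: "'v \<Rightarrow> 'v"
  assumes m: "m \<ge> 5"
    and periodic: "\<And>i a. a \<in> {1, 2} \<Longrightarrow> v (i + int m) a = v i a"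
    and cell: "\<And>i. C i = {v i 1, v i 2}"
    and cell_card: "\<And>i. card (C i) = 2"
    and cells_disjoint: "\<And>i j. \<not> [i = j] (mod int m) \<Longrightarrow> C i \<inter> C j = {}"
    and D_disjoint: "\<And>i. C i \<inter> D = {}"
    and cover: "(\<Union>i. C i) \<union> D = UNIV"
    and parity: "\<And>x i j. x \<in> D \<Longrightarrow>
      [card (nbrs_in E x (C i)) = card (nbrs_in E x (C j))] (mod 2)"
    and dist1: "\<And>i j. j = i + 1 \<Longrightarrow> induced_edges E (C i \<union> C j) \<in>
      {{{v i 1, v j 1}, {v i 1, v j 2}}, {{v i 2, v j 1}, {v i 2, v j 2}}}"
    and dist2: "\<And>i j. j = i + 2 \<Longrightarrow> induced_edges E (C i \<union> C j) \<in>
      {{{v i 1, v j 1}, {v i 2, v j 1}}, {{v i 1, v j 2}, {v i 2, v j 2}}}"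
    and dist3: "\<And>i j. j \<in> {i + 3..i + int (m div 2)} \<Longrightarrow> induced_edges E (C i \<union> C j) \<in>
      {{}, {{v i 1, v j 1}, {v i 1, v j 2}, {v i 2, v j 1}, {v i 2, v j 2}}}"
    and shift: "\<And>i a. a \<in> {1, 2} \<Longrightarrow> \<pi> (v i a) = v (i - 1) a"
begin

text \<open>Indexing the two vertices of a cell by \<open>bool\<close> makes the swap \<open>Not\<close> and removes the side
  conditions \<open>a \<in> {1, 2}\<close>.\<close>

definition u :: "int \<Rightarrow> bool \<Rightarrow> 'v" where
  "u i p = v i (if p then 1 else 2)"

lemma u_simps: "u i True = v i 1" "u i False = v i 2"
  by (simp_all add: u_def)

lemma v_eq_u: "v i 1 = u i True" "v i (Suc 0) = u i True" "v i 2 = u i False"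
  by (simp_all add: u_def)

lemma cell_u: "C i = {u i True, u i False}"
  by (simp add: cell u_simps)

lemma u_in_cell [simp]: "u i p \<in> C i"
  by (cases p) (simp_all add: cell_u)

lemma in_cell_iff: "x \<in> C i \<longleftrightarrow> (\<exists>p. x = u i p)"
  by (auto simp: cell_u ex_bool_eq)

lemma u_notin_D [simp]: "u i p \<notin> D"
  using D_disjoint[of i] u_in_cell[of i p] by blast

lemma vertex_cases:
  obtains "x \<in> D" | i p where "x = u i p"
proof -
  have "x \<in> (\<Union>i. C i) \<union> D"
    using cover by simp
  then show ?thesis
    using that in_cell_iff by blast
qed

lemma u_cong:
  assumes "[i = j] (mod int m)"
  shows "u i p = u j p"
proof -
  have per: "u (k + int m) p = u k p" for k
    by (simp add: u_def periodic)
  have nat: "u (k + int m * int n) p = u k p" for k n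
  proof (induction n)
    case (Suc n)
    have "k + int m * int (Suc n) = (k + int m * int n) + int m"
      by (simp add: algebra_simps)
    with Suc per show ?case
      by metis
  qed simp
  obtain k where "i - j = int m * k"
    using assms by (auto simp: cong_iff_dvd_diff)
  then have k: "i = j + int m * k"
    by simp
  show ?thesis
  proof (cases "k \<ge> 0")
    case True
    with nat[of j "nat k"] k show ?thesis by simp
  next
    case False
    with nat[of i "nat (- k)"] k show ?thesis by simp
  qed
qed

lemma u_eq_iff: "u i p = u j q \<longleftrightarrow> [i = j] (mod int m) \<and> p = q"
proof
  assume eq: "u i p = u j q"
  then have ij: "[i = j] (mod int m)"
    using cells_disjoint[of i j] u_in_cell[of i p] u_in_cell[of j q] by (metis disjoint_iff)
  moreover have "u i True \<noteq> u i False"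
    using cell_card[of i] by (auto simp: cell_u)
  ultimately show "[i = j] (mod int m) \<and> p = q"
    using eq u_cong[OF ij] by (cases p; cases q) metis+
qed (use u_cong in blast)

lemma u_in_cell_iff: "u i p \<in> C j \<longleftrightarrow> [i = j] (mod int m)"
  by (auto simp: in_cell_iff u_eq_iff)

lemma not_dvd: "0 < \<bar>k\<bar> \<Longrightarrow> \<bar>k\<bar> < int m \<Longrightarrow> \<not> int m dvd k"
  using dvd_imp_le_int[of k "int m"] by force

text \<open>The bound on \<open>d\<close> excludes a match in swapped order: it would make m divide
  \<open>d + c\<close>, which lies strictly between 0 and m. A match in the same order makes m
  divide \<open>d - c\<close>, hence \<open>d = c\<close>.\<close>

lemma pair_eq_iff:
  assumes d: "0 \<le> d" "d \<le> int m - 3" and c: "c \<in> {1, 2}"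
  shows "{u i p, u (i + d) q} = {u k p', u (k + c) q'} \<longleftrightarrow>
    d = c \<and> [i = k] (mod int m) \<and> p = p' \<and> q = q'"
proof
  assume eq: "{u i p, u (i + d) q} = {u k p', u (k + c) q'}"
  show "d = c \<and> [i = k] (mod int m) \<and> p = p' \<and> q = q'"
  proof (cases "[i = k] (mod int m) \<and> [i + d = k + c] (mod int m)")
    case True
    then have "int m dvd (i + d - (k + c)) - (i - k)"
      by (meson cong_iff_dvd_diff dvd_diff)
    then have "int m dvd d - c"
      by (simp add: algebra_simps)
    then have dc: "d = c"
      using d c m not_dvd[of "d - c"] by force
    moreover have "\<not> int m dvd c" "\<not> int m dvd - c"
      using c m not_dvd[of c] not_dvd[of "- c"] by auto
    then have "\<not> [i = k + c] (mod int m)"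
      using True cong_trans[of i k "int m"] unfolding cong_iff_dvd_diff
      by (metis add_diff_cancel_left' cong_iff_dvd_diff cong_sym cong_trans minus_diff_eq)
    ultimately show ?thesis
      using eq True by (auto simp: doubleton_eq_iff u_eq_iff)
  next
    case False
    with eq have "[i = k + c] (mod int m)" "[i + d = k] (mod int m)"
      by (auto simp: doubleton_eq_iff u_eq_iff)
    then have "int m dvd (i + d - k) - (i - (k + c))"
      by (meson cong_iff_dvd_diff dvd_diff)
    then have "int m dvd d + c"
      by (simp add: algebra_simps)
    then show ?thesis
      using d c m not_dvd[of "d + c"] by force
  qed
next
  assume "d = c \<and> [i = k] (mod int m) \<and> p = p' \<and> q = q'"
  then show "{u i p, u (i + d) q} = {u k p', u (k + c) q'}"
    using u_cong[of i k] u_cong[of "i + c" "k + c"] by (auto simp: cong_add_rcancel)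
qed

section \<open>Blocks of the original adjacency matrix\<close>

abbreviation adj :: "'v \<Rightarrow> 'v \<Rightarrow> bool" where
  "adj x y \<equiv> {x, y} \<in> E"

abbreviation E' :: "'v set set" where
  "E' \<equiv> switched_graph E v C D \<pi>"

abbreviation adj' :: "'v \<Rightarrow> 'v \<Rightarrow> bool" where
  "adj' x y \<equiv> {x, y} \<in> E'"

lemma adj_iff_induced: "adj (u i p) (u j q) \<longleftrightarrow> {u i p, u j q} \<in> induced_edges E (C i \<union> C j)"
  by (simp add: induced_edges_def)

text \<open>The four pairs between the two cells are distinct by \<open>pair_eq_iff\<close>, so the
  alternatives of \<open>dist1\<close> can be read entry by entry: the 2 by 2 block has one row of
  ones and one of zeros.\<close>

lemma adj_succ_row: "\<exists>p0. \<forall>p q. adj (u i p) (u (i + 1) q) \<longleftrightarrow> p = p0"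
proof -
  have *: "{u i p, u (i + 1) q} = {u i p', u (i + 1) q'} \<longleftrightarrow> p = p' \<and> q = q'" for p q p' q'
    using m by (subst pair_eq_iff) auto
  show ?thesis
    using dist1[of "i + 1" i] unfolding adj_iff_induced
    by (auto simp: v_eq_u * ex_bool_eq all_bool_eq)
qed

lemma adj_succ2_col: "\<exists>q0. \<forall>p q. adj (u i p) (u (i + 2) q) \<longleftrightarrow> q = q0"
proof -
  have *: "{u i p, u (i + 2) q} = {u i p', u (i + 2) q'} \<longleftrightarrow> p = p' \<and> q = q'" for p q p' q'
    using m by (subst pair_eq_iff) auto
  show ?thesis
    using dist2[of "i + 2" i] unfolding adj_iff_induced
    by (auto simp: v_eq_u * ex_bool_eq all_bool_eq)
qed

text \<open>An edge inside a cell would be induced on \<open>C i\<close> and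
  \<open>C (i + 1)\<close>, but all edges listed by \<open>dist1\<close> join two different
  cells.\<close>

lemma not_adj_cell: "\<not> adj (u i p) (u i q)"
proof
  assume "adj (u i p) (u i q)"
  then have "{u i p, u (i + 0) q} \<in> induced_edges E (C i \<union> C (i + 1))"
    by (simp add: induced_edges_def)
  moreover have "{u i p, u (i + 0) q} \<noteq> {u i p', u (i + 1) q'}" for p' q'
    using m by (subst pair_eq_iff) auto
  ultimately show False
    using dist1[of "i + 1" i] by (auto simp: v_eq_u)
qed

text \<open>\<open>dist3\<close> stops at distance \<open>m div 2\<close>. A larger \<open>d\<close>
  becomes \<open>m - d\<close> when the pair is read from the other cell, and \<open>m - d\<close>
  lies between 3 and \<open>m div 2\<close>.\<close>

lemma adj_far_const:
  assumes "3 \<le> d" "d \<le> int m - 3"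
  shows "\<exists>c. \<forall>p q. adj (u i p) (u (i + d) q) \<longleftrightarrow> c"
proof -
  have *: "\<exists>c. \<forall>p q. adj (u k p) (u (k + e) q) \<longleftrightarrow> c" if "3 \<le> e" "e \<le> int (m div 2)" for k e
    using dist3[of "k + e" k] that unfolding adj_iff_induced
    by (auto simp: v_eq_u ex_bool_eq all_bool_eq)
  show ?thesis
  proof (cases "d \<le> int (m div 2)")
    case False
    have "u (i + d + (int m - d)) p = u i p" for p
      by (rule u_cong) (simp add: cong_iff_dvd_diff)
    then show ?thesis
      using *[of "int m - d" "i + d"] False assms by (force simp: insert_commute)
  qed (use * assms in blast)
qed

text \<open>Supplies the blocks with equal rows, which N annihilates from the left.\<close>

lemma adj_row_const:
  assumes "2 \<le> d" "d \<le> int m - 3"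
  shows "\<exists>P. \<forall>p q. adj (u i p) (u (i + d) q) \<longleftrightarrow> P q"
proof (cases "d = 2")
  case True
  obtain q0 where "\<forall>p q. adj (u i p) (u (i + 2) q) \<longleftrightarrow> q = q0"
    using adj_succ2_col[of i] by blast
  with True show ?thesis
    by (intro exI[of _ "\<lambda>q. q = q0"]) simp
next
  case False
  then obtain c where "\<forall>p q. adj (u i p) (u (i + d) q) \<longleftrightarrow> c"
    using adj_far_const[of d i] assms by auto
  then show ?thesis
    by (intro exI[of _ "\<lambda>_. c"]) simp
qed

text \<open>Transposing turns distance \<open>d\<close> into \<open>m - d\<close> and equal rows
  into equal columns; N annihilates such blocks from the right.\<close>

lemma adj_col_const:
  assumes "3 \<le> d" "d \<le> int m - 2"
  shows "\<exists>P. \<forall>p q. adj (u i p) (u (i + d) q) \<longleftrightarrow> P p"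
proof -
  obtain P where P: "\<forall>p q. adj (u (i + d) p) (u (i + d + (int m - d)) q) \<longleftrightarrow> P q"
    using adj_row_const[of "int m - d" "i + d"] assms by auto
  have "u (i + d + (int m - d)) p = u i p" for p
    by (rule u_cong) (simp add: cong_iff_dvd_diff)
  with P have "adj (u i p) (u (i + d) q) \<longleftrightarrow> P p" for p q
    by (metis insert_commute)
  then show ?thesis
    by blast
qed

section \<open>Adjacency after switching\<close>

lemma notin_single_nbr [simp]: "u i p \<notin> single_nbr E C D"
  by (simp add: single_nbr_def)

lemma removed_cells_iff:
  assumes "0 \<le> d" "d \<le> int m - 3"
  shows "{u i p, u (i + d) q} \<in> removed_edges E C D \<longleftrightarrow> adj (u i p) (u (i + d) q) \<and> d < 3"
proof -
  \<comment> \<open>Two cells among \<open>C k\<close> and \<open>C (k + c)\<close> have index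
    difference 0, c or -c modulo m, whereas m divides none of \<open>d\<close>,
    \<open>d - c\<close>, \<open>d + c\<close>.\<close>
  have far: "\<not> {u i p, u (i + d) q} \<subseteq> C k \<union> C (k + c)" if "3 \<le> d" "c \<in> {1, 2}" for k c
  proof
    assume "{u i p, u (i + d) q} \<subseteq> C k \<union> C (k + c)"
    then have "int m dvd i - k \<or> int m dvd i - (k + c)"
      "int m dvd i + d - k \<or> int m dvd i + d - (k + c)"
      by (auto simp: u_in_cell_iff cong_iff_dvd_diff)
    moreover have "i + d - k - (i - k) = d" "i + d - (k + c) - (i - k) = d - c"
      "i + d - k - (i - (k + c)) = d + c" "i + d - (k + c) - (i - (k + c)) = d"
      by simp_all
    ultimately have "int m dvd d \<or> int m dvd d - c \<or> int m dvd d + c"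
      by (metis dvd_diff)
    moreover have "\<not> int m dvd d" "\<not> int m dvd d - c" "\<not> int m dvd d + c"
      using that assms not_dvd[of d] not_dvd[of "d - c"] not_dvd[of "d + c"] by auto
    ultimately show False
      by blast
  qed
  have near: "{u i p, u (i + d) q} \<subseteq> C i \<union> C (i + d)"
    by simp
  have D: "{u i p, u (i + d) q} \<notin> {{x, w} | x w i. x \<in> single_nbr E C D \<and> w \<in> nbrs_in E x (C i)}"
    by (auto simp: doubleton_eq_iff nbrs_in_def in_cell_iff)
  consider "d = 0" | "d \<in> {1, 2}" | "3 \<le> d"
    using assms by fastforce
  then show ?thesis
  proof cases
    \<comment> \<open>Both sides are false: removed edges belong to \<open>E\<close>, which has no
      edge inside a cell.\<close>
    case 1
    have "removed_edges E C D \<subseteq> E"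
      by (auto simp: removed_edges_def induced_edges_def nbrs_in_def)
    with 1 show ?thesis
      using not_adj_cell by auto
  next
    case 2
    have "removed_edges E C D \<subseteq> E"
      by (auto simp: removed_edges_def induced_edges_def nbrs_in_def)
    moreover have "induced_edges E (C i \<union> C (i + d)) \<subseteq> removed_edges E C D"
      using 2 unfolding removed_edges_def by blast
    ultimately show ?thesis
      using 2 near by (auto simp: induced_edges_def)
  next
    case 3
    with D far[of 1] far[of 2] show ?thesis
      unfolding removed_edges_def induced_edges_def by auto
  qed
qed

text \<open>By \<open>pair_eq_iff\<close> an added edge determines its distance, its first cell
  modulo m and both labels. Hence the two families of new edges between cells do not interfere, and
  \<open>u_cong\<close> replaces the index \<open>k\<close> by \<open>i\<close>.\<close>

lemma added_cells_iff:
  assumes "0 \<le> d" "d \<le> int m - 3"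
  shows "{u i p, u (i + d) q} \<in> added_edges E v C D \<pi> \<longleftrightarrow>
    d = 1 \<and> adj (u i p) (u (i + 2) q) \<or> d = 2 \<and> adj (u (i + 1) p) (u (i + 2) q)"
proof -
  have bool: "(\<exists>a b. X = {v k a, v l b} \<and> a \<in> {1, 2} \<and> b \<in> {1, 2} \<and> adj (v k' a) (v l' b)) \<longleftrightarrow>
      (\<exists>p q. X = {u k p, u l q} \<and> adj (u k' p) (u l' q))" for X k l k' l'
    by (auto simp: u_def ex_bool_eq)
  have "{u i p, u (i + d) q} \<notin> {{x, \<pi> w} | x w i. x \<in> single_nbr E C D \<and> w \<in> nbrs_in E x (C i)}"
    by (auto simp: doubleton_eq_iff)
  then have "{u i p, u (i + d) q} \<in> added_edges E v C D \<pi> \<longleftrightarrow>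
    (\<exists>k p' q'. {u i p, u (i + d) q} = {u k p', u (k + 1) q'} \<and> adj (u k p') (u (k + 2) q')) \<or>
    (\<exists>k p' q'. {u i p, u (i + d) q} = {u k p', u (k + 2) q'} \<and> adj (u (k + 1) p') (u (k + 2) q'))"
    unfolding added_edges_def Un_iff mem_Collect_eq bool by blast
  also have "\<dots> \<longleftrightarrow>
    d = 1 \<and> (\<exists>k. [i = k] (mod int m) \<and> adj (u k p) (u (k + 2) q)) \<or>
    d = 2 \<and> (\<exists>k. [i = k] (mod int m) \<and> adj (u (k + 1) p) (u (k + 2) q))"
    by (subst (1 2) pair_eq_iff) (use assms in auto)
  also have "\<dots> \<longleftrightarrow> d = 1 \<and> adj (u i p) (u (i + 2) q) \<or> d = 2 \<and> adj (u (i + 1) p) (u (i + 2) q)"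
  proof -
    have "u k p = u i p" "u (k + 1) p = u (i + 1) p" "u (k + 2) q = u (i + 2) q"
      if "[i = k] (mod int m)" for k
      using that by (auto intro!: u_cong simp: cong_sym_eq cong_add_rcancel)
    then show ?thesis
      by (metis cong_refl)
  qed
  finally show ?thesis .
qed

lemma adj'_cells:
  assumes "0 \<le> d" "d \<le> int m - 3"
  shows "adj' (u i p) (u (i + d) q) \<longleftrightarrow>
    (if d = 0 then False else if d = 1 then adj (u i p) (u (i + 2) q)
     else if d = 2 then adj (u (i + 1) p) (u (i + 2) q) else adj (u i p) (u (i + d) q))"
  using assms not_adj_cell unfolding switched_graph_def
  by (auto simp: removed_cells_iff added_cells_iff)

lemma \<pi>_u: "\<pi> (u i p) = u (i - 1) p"
  by (simp add: u_def shift)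

lemma in_cell_notin_D: "w \<in> C i \<Longrightarrow> w \<notin> D"
  by (auto simp: in_cell_iff)

lemma adj'_D:
  assumes "x \<in> D" "y \<in> D"
  shows "adj' x y \<longleftrightarrow> adj x y"
proof -
  have "{x, y} \<notin> removed_edges E C D"
    using assms by (auto simp: removed_edges_def induced_edges_def nbrs_in_def doubleton_eq_iff
        dest: in_cell_notin_D)
  moreover have "{x, y} \<notin> added_edges E v C D \<pi>"
    using assms by (auto simp: added_edges_def nbrs_in_def doubleton_eq_iff in_cell_iff \<pi>_u v_eq_u)
  ultimately show ?thesis
    by (simp add: switched_graph_def)
qed

text \<open>As \<pi> lowers the cell index by one, an edge moved to \<open>u i p\<close> comes from
  \<open>u (i + 1) p\<close>.\<close>

lemma adj'_D_cell:
  assumes x: "x \<in> D"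
  shows "adj' x (u i p) \<longleftrightarrow> (if x \<in> single_nbr E C D then adj x (u (i + 1) p) else adj x (u i p))"
proof -
  have xC: "x \<notin> C k" for k
    using x in_cell_notin_D by blast
  have removed: "{x, u i p} \<in> removed_edges E C D \<longleftrightarrow> x \<in> single_nbr E C D \<and> adj x (u i p)"
  proof
    assume "x \<in> single_nbr E C D \<and> adj x (u i p)"
    then show "{x, u i p} \<in> removed_edges E C D"
      unfolding removed_edges_def nbrs_in_def using u_in_cell[of i p] by blast
  qed (use xC in \<open>auto simp: removed_edges_def induced_edges_def nbrs_in_def doubleton_eq_iff\<close>)
  have added: "{x, u i p} \<in> added_edges E v C D \<pi> \<longleftrightarrow> x \<in> single_nbr E C D \<and> adj x (u (i + 1) p)"
  proof
    assume *: "x \<in> single_nbr E C D \<and> adj x (u (i + 1) p)"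
    have "{x, u i p} = {x, \<pi> (u (i + 1) p)}"
      by (simp add: \<pi>_u)
    moreover have "u (i + 1) p \<in> nbrs_in E x (C (i + 1))"
      using * by (simp add: nbrs_in_def)
    ultimately show "{x, u i p} \<in> added_edges E v C D \<pi>"
      unfolding added_edges_def using * by blast
  next
    assume "{x, u i p} \<in> added_edges E v C D \<pi>"
    then obtain y w k where y: "{x, u i p} = {y, \<pi> w}" "y \<in> single_nbr E C D"
      and w: "w \<in> nbrs_in E y (C k)"
      unfolding added_edges_def using x by (auto simp: doubleton_eq_iff v_eq_u)
    moreover obtain q where q: "w = u k q" "adj y (u k q)"
      using w by (auto simp: nbrs_in_def in_cell_iff)
    ultimately have "x = y" "u i p = u (k - 1) q"
      by (auto simp: \<pi>_u doubleton_eq_iff)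
    moreover from this have "u (i + 1) p = u k q"
      using cong_add_rcancel[of i 1 "k - 1" "int m"] by (simp add: u_eq_iff)
    ultimately show "x \<in> single_nbr E C D \<and> adj x (u (i + 1) p)"
      using y q by simp
  qed
  show ?thesis
    by (auto simp: switched_graph_def removed added)
qed

lemma card_nbrs_in_cell:
  "card (nbrs_in E x (C i)) = of_bool (adj x (u i True)) + of_bool (adj x (u i False))"
proof -
  have "nbrs_in E x (C i) = (if adj x (u i True) then {u i True} else {}) \<union>
      (if adj x (u i False) then {u i False} else {})"
    by (auto simp: nbrs_in_def cell_u)
  then show ?thesis
    by (simp add: u_eq_iff)
qed

lemma adj_single:
  assumes "x \<in> single_nbr E C D"
  shows "adj x (u i (\<not> p)) \<longleftrightarrow> \<not> adj x (u i p)"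
proof -
  have "card (nbrs_in E x (C i)) = 1"
    using assms by (simp add: single_nbr_def)
  then show ?thesis
    by (cases p) (auto simp: card_nbrs_in_cell of_bool_def split: if_splits)
qed

text \<open>Some cell contains 0 or 2 neighbours of \<open>x\<close>, and by \<open>parity\<close>
  then every cell does.\<close>

lemma adj_not_single:
  assumes x: "x \<in> D" and "x \<notin> single_nbr E C D"
  shows "adj x (u i (\<not> p)) \<longleftrightarrow> adj x (u i p)"
proof -
  obtain j where "card (nbrs_in E x (C j)) \<noteq> 1"
    using assms by (auto simp: single_nbr_def)
  then have "even (card (nbrs_in E x (C j)))"
    by (cases "adj x (u j True)"; cases "adj x (u j False)") (simp_all add: card_nbrs_in_cell)
  then have "even (card (nbrs_in E x (C i)))"
    using parity[OF x, of i j] by (simp add: cong_def even_iff_mod_2_eq_zero)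
  then show ?thesis
    by (cases p) (auto simp: card_nbrs_in_cell of_bool_def split: if_splits)
qed

section \<open>The permutations S and T of the vertices\<close>

definition partner :: "'v \<Rightarrow> 'v" where
  "partner x = (if x \<in> D then x else SOME y. \<exists>i p. x = u i p \<and> y = u i (\<not> p))"

definition next_cell :: "'v \<Rightarrow> 'v" where
  "next_cell x = (if x \<in> D then x else SOME y. \<exists>i p. x = u i p \<and> y = u (i + 1) p)"

lemma partner_D [simp]: "x \<in> D \<Longrightarrow> partner x = x"
  by (simp add: partner_def)

lemma next_cell_D [simp]: "x \<in> D \<Longrightarrow> next_cell x = x"
  by (simp add: next_cell_def)

text \<open>The choice is independent of the representative, because \<open>u_eq_iff\<close>
  recovers \<open>i\<close> modulo m and \<open>p\<close> from the vertex.\<close>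

lemma partner_u [simp]: "partner (u i p) = u i (\<not> p)"
proof -
  have "(SOME y. \<exists>j q. u i p = u j q \<and> y = u j (\<not> q)) = u i (\<not> p)"
    by (rule some_equality, blast) (auto simp: u_eq_iff cong_sym_eq)
  then show ?thesis
    by (simp add: partner_def)
qed

lemma next_cell_u [simp]: "next_cell (u i p) = u (i + 1) p"
proof -
  have "(SOME y. \<exists>j q. u i p = u j q \<and> y = u (j + 1) q) = u (i + 1) p"
    by (rule some_equality, blast) (auto simp: u_eq_iff cong_sym_eq cong_add_rcancel)
  then show ?thesis
    by (simp add: next_cell_def)
qed

abbreviation Q :: "real^'v^'v" where
  "Q \<equiv> shift_matrix partner next_cell"

lemma Q_orthogonal: "Q ** transpose Q = mat 1"
proof (rule shift_matrix_orthogonal)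
  show "partner (partner x) = x" for x
    by (cases x rule: vertex_cases) auto
  show "next_cell (partner x) = partner (next_cell x)" for x
    by (cases x rule: vertex_cases) auto
  show "inj next_cell"
  proof (rule injI)
    fix x y
    assume "next_cell x = next_cell y"
    moreover have "u (i + 1) p \<noteq> z" if "z \<in> D" for i p z
      using that u_notin_D by blast
    ultimately show "x = y"
      by (cases x rule: vertex_cases; cases y rule: vertex_cases)
        (auto simp: u_eq_iff cong_add_rcancel)
  qed
qed

section \<open>Entries of the conjugated adjacency matrix\<close>

definition adj_val :: "'v \<Rightarrow> 'v \<Rightarrow> real" where
  "adj_val x y = of_bool (adj x y)"

text \<open>The entry of Q A Q^T at \<open>x\<close>, \<open>y\<close>, in the form given by
  \<open>shift_matrix_conj\<close>.\<close>

definition conj_val :: "'v \<Rightarrow> 'v \<Rightarrow> real" where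
  "conj_val x y = shift_op partner next_cell (\<lambda>k. shift_op partner next_cell (\<lambda>l. adj_val l k) x) y"

lemma adj_val_sym: "adj_val x y = adj_val y x"
  by (simp add: adj_val_def insert_commute)

lemma conj_val_sym: "conj_val x y = conj_val y x"
  unfolding conj_val_def shift_op_def
  by (simp add: add_divide_distrib diff_divide_distrib
      adj_val_sym[of y] adj_val_sym[of "partner y"] adj_val_sym[of "next_cell y"]
      adj_val_sym[of "partner (next_cell y)"])

lemma conj_val_D_D:
  assumes "x \<in> D" "y \<in> D"
  shows "conj_val x y = of_bool (adj' x y)"
  using assms by (simp add: conj_val_def shift_op_def adj'_D adj_val_def)

text \<open>On \<open>D\<close> the operator is the identity, so only the cell argument matters. If
  \<open>x\<close> is in \<open>single_nbr E C D\<close>, the two entries for cell \<open>i\<close>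
  sum to 1 and those for cell \<open>i + 1\<close> differ by 1 or -1, which gives the shifted entry.
  Otherwise the difference is 0 and the half-sum is the old entry.\<close>

lemma conj_val_D_cell:
  assumes "x \<in> D"
  shows "conj_val x (u i p) = of_bool (adj' x (u i p))"
  using assms adj_single[of x i p] adj_single[of x "i + 1" p]
    adj_not_single[of x i p] adj_not_single[of x "i + 1" p]
  by (cases "x \<in> single_nbr E C D") (auto simp: conj_val_def shift_op_def adj'_D_cell adj_val_def)

text \<open>The four groups of four terms are P A(i,j) P, N A(i+1,j) P, P A(i,j+1) N and N
  A(i+1,j+1) N.\<close>

lemma conj_val_u:
  "conj_val (u i p) (u j q) =
    (adj_val (u i p) (u j q) + adj_val (u i (\<not> p)) (u j q)
      + adj_val (u i p) (u j (\<not> q)) + adj_val (u i (\<not> p)) (u j (\<not> q))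
    + adj_val (u (i + 1) p) (u j q) - adj_val (u (i + 1) (\<not> p)) (u j q)
      + adj_val (u (i + 1) p) (u j (\<not> q)) - adj_val (u (i + 1) (\<not> p)) (u j (\<not> q))
    + adj_val (u i p) (u (j + 1) q) + adj_val (u i (\<not> p)) (u (j + 1) q)
      - adj_val (u i p) (u (j + 1) (\<not> q)) - adj_val (u i (\<not> p)) (u (j + 1) (\<not> q))
    + adj_val (u (i + 1) p) (u (j + 1) q) - adj_val (u (i + 1) (\<not> p)) (u (j + 1) q)
      - adj_val (u (i + 1) p) (u (j + 1) (\<not> q)) + adj_val (u (i + 1) (\<not> p)) (u (j + 1) (\<not> q))) / 4"
  unfolding conj_val_def shift_op_def partner_u next_cell_u
  by (simp add: add_divide_distrib diff_divide_distrib)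

text \<open>The remaining residues \<open>d = m - 2\<close> and \<open>d = m - 1\<close> follow by symmetry.\<close>

lemma conj_val_cells:
  assumes "0 \<le> d" "d \<le> int m - 3"
  shows "conj_val (u i p) (u (i + d) q) = of_bool (adj' (u i p) (u (i + d) q))"
proof -
  consider "d = 0" | "d = 1" | "d = 2" | "3 \<le> d"
    using assms by linarith
  then show ?thesis
  proof cases
    \<comment> \<open>The diagonal blocks are zero, A(i,i+1) has equal columns and its transpose
      A(i+1,i) has equal rows, so all four terms vanish.\<close>
    case 1
    obtain p0 where "\<And>p q. adj_val (u i p) (u (i + 1) q) = of_bool (p = p0)"
      using adj_succ_row[of i] unfolding adj_val_def of_bool_eq_iff by blast
    moreover from this have "adj_val (u (i + 1) q) (u i p) = of_bool (p = p0)" for p q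
      by (metis adj_val_sym)
    moreover have "adj_val (u k p) (u k q) = 0" for k p q
      by (simp add: adj_val_def not_adj_cell)
    ultimately show ?thesis
      unfolding conj_val_u adj'_cells[OF assms] using 1 by simp
  \<comment> \<open>P A(i,i+1) P is 1/2 everywhere, and P A(i,i+2) N is 1/2 in column
    \<open>q0\<close> and -1/2 in the other, so the sum is A(i,i+2).\<close>
  next
    case 2
    then have j1: "i + d + 1 = i + 2"
      by simp
    obtain p0 where "\<And>p q. adj_val (u i p) (u (i + 1) q) = of_bool (p = p0)"
      using adj_succ_row[of i] unfolding adj_val_def of_bool_eq_iff by blast
    moreover have "adj_val (u (i + 1) p) (u (i + 1) q) = 0" for p q
      by (simp add: adj_val_def not_adj_cell)
    moreover obtain q0 where "\<And>p q. adj_val (u i p) (u (i + 2) q) = of_bool (q = q0)"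
      and *: "\<And>p q. adj (u i p) (u (i + 2) q) \<longleftrightarrow> q = q0"
      using adj_succ2_col[of i] unfolding adj_val_def of_bool_eq_iff by blast
    moreover obtain p1 where "\<And>p q. adj_val (u (i + 1) p) (u (i + 2) q) = of_bool (p = p1)"
      using adj_succ_row[of "i + 1"] unfolding adj_val_def of_bool_eq_iff add.assoc one_add_one by blast
    ultimately show ?thesis
      unfolding conj_val_u j1 adj'_cells[OF assms] using 2
      by (simp add: *) (cases p0; cases p; cases q; cases q0; simp)
  \<comment> \<open>P A(i,i+2) P is 1/2 everywhere, and N A(i+1,i+2) P is 1/2 in row
    \<open>p1\<close> and -1/2 in the other, so the sum is A(i+1,i+2). For m = 5 the distance 3 of
    A(i,i+3) exceeds \<open>m div 2\<close>, so \<open>adj_col_const\<close> is used for its equal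
    columns.\<close>
  next
    case 3
    then have j1: "i + d + 1 = i + 3"
      by simp
    obtain q0 where "\<And>p q. adj_val (u i p) (u (i + 2) q) = of_bool (q = q0)"
      using adj_succ2_col[of i] unfolding adj_val_def of_bool_eq_iff by blast
    moreover obtain p1 where "\<And>p q. adj_val (u (i + 1) p) (u (i + 2) q) = of_bool (p = p1)"
      and *: "\<And>p q. adj (u (i + 1) p) (u (i + 2) q) \<longleftrightarrow> p = p1"
      using adj_succ_row[of "i + 1"] unfolding adj_val_def of_bool_eq_iff add.assoc one_add_one by blast
    moreover obtain P where "\<And>p q. adj_val (u i p) (u (i + 3) q) = of_bool (P p)"
      using adj_col_const[of 3 i] m unfolding adj_val_def of_bool_eq_iff by auto
    moreover obtain q1 where "\<And>p q. adj_val (u (i + 1) p) (u (i + 3) q) = of_bool (q = q1)"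
      using adj_succ2_col[of "i + 1"] unfolding adj_val_def of_bool_eq_iff by (auto simp: add.assoc)
    ultimately show ?thesis
      unfolding conj_val_u j1 adj'_cells[OF assms] using 3
      by (simp add: *) (cases p1; cases p; cases q; cases q0; cases q1; simp)
  \<comment> \<open>Only P A(i,i+d) P survives. The neighbouring distances \<open>d - 1\<close> and
    \<open>d + 1\<close> stay within the ranges of \<open>adj_row_const\<close> and
    \<open>adj_col_const\<close>.\<close>
  next
    case 4
    obtain c where "\<And>p q. adj_val (u i p) (u (i + d) q) = of_bool c"
      and *: "\<And>p q. adj (u i p) (u (i + d) q) \<longleftrightarrow> c"
      using adj_far_const[of d i] 4 assms unfolding adj_val_def of_bool_eq_iff by blast
    moreover obtain c' where "\<And>p q. adj_val (u (i + 1) p) (u (i + d + 1) q) = of_bool c'"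
      using adj_far_const[of d "i + 1"] 4 assms unfolding adj_val_def of_bool_eq_iff
      by (auto simp: add_ac)
    moreover obtain P where "\<And>p q. adj_val (u i p) (u (i + d + 1) q) = of_bool (P p)"
      using adj_col_const[of "d + 1" i] 4 assms unfolding adj_val_def of_bool_eq_iff
      by (auto simp: add_ac)
    moreover obtain P' where "\<And>p q. adj_val (u (i + 1) p) (u (i + d) q) = of_bool (P' q)"
      using adj_row_const[of "d - 1" "i + 1"] 4 assms unfolding adj_val_def of_bool_eq_iff by auto
    ultimately show ?thesis
      unfolding conj_val_u adj'_cells[OF assms] using 4 by (simp add: *)
  qed
qed

lemma conj_val_eq: "conj_val x y = of_bool (adj' x y)"
proof -
  have cells: "conj_val (u i p) (u j q) = of_bool (adj' (u i p) (u j q))" for i j p q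
  proof -
    define d where "d = (j - i) mod int m"
    have d: "0 \<le> d" "d < int m"
      using m by (simp_all add: d_def)
    have "[d = j - i] (mod int m)"
      by (simp add: d_def)
    then have "int m dvd d - (j - i)"
      by (simp add: cong_iff_dvd_diff)
    moreover have "i + d - j = d - (j - i)" "j + (int m - d) - i = int m - (d - (j - i))"
      by simp_all
    ultimately have "[i + d = j] (mod int m)" "[j + (int m - d) = i] (mod int m)"
      by (metis cong_iff_dvd_diff dvd_diff dvd_refl)+
    then have uj: "u (i + d) r = u j r" "u (j + (int m - d)) r = u i r" for r
      using u_cong by blast+
    show ?thesis
    proof (cases "d \<le> int m - 3")
      case True
      with conj_val_cells[of d i p q] d show ?thesis
        by (simp add: uj)
    next
      \<comment> \<open>Now \<open>m - d\<close> is 1 or 2, which is at most \<open>m - 3\<close>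
        because \<open>m\<close> is at least 5.\<close>
      case False
      with conj_val_cells[of "int m - d" j q p] d m show ?thesis
        by (simp add: uj conj_val_sym insert_commute)
    qed
  qed
  have "conj_val (u i p) z = of_bool (adj' (u i p) z)" if "z \<in> D" for i p z
    using conj_val_D_cell[OF that] by (simp add: conj_val_sym[of "u i p"] insert_commute)
  then show ?thesis
    using cells conj_val_D_D conj_val_D_cell
    by (cases x rule: vertex_cases; cases y rule: vertex_cases) auto
qed

lemma R_cospectral: "R_cospectral E E'"
proof -
  have "Q ** (adj_matrix E + r *\<^sub>R all_ones) ** transpose Q = adj_matrix E' + r *\<^sub>R all_ones" for r
  proof -
    \<comment> \<open>The coefficients of \<open>shift_op\<close> sum to 1, so constants are
      preserved and the same Q serves every \<open>r\<close>.\<close>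
    have "shift_op partner next_cell (\<lambda>k. shift_op partner next_cell (\<lambda>l. adj_val l k + r) x) y =
      conj_val x y + r" for x y
      by (simp add: conj_val_def shift_op_def field_simps)
    then show ?thesis
      by (simp add: vec_eq_iff shift_matrix_conj adj_matrix_def all_ones_def conj_val_eq adj_val_def
          of_bool_def)
  qed
  then show ?thesis
    unfolding R_cospectral_def using spectrum_similar[OF Q_orthogonal] by metis
qed

end

theorem theorem8:
  fixes m :: nat
    and E :: "'v::finite set set"
    and v :: "int \<Rightarrow> nat \<Rightarrow> 'v"
    and C :: "int \<Rightarrow> 'v set"
    and D :: "'v set"
    and \<pi> :: "'v \<Rightarrow> 'v"
  assumes m: "m \<ge> 5"
    and graph: "simple_graph E"
    and periodic: "\<And>i a. a \<in> {1, 2} \<Longrightarrow> v (i + int m) a = v i a"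
    and cell: "\<And>i. C i = {v i 1, v i 2}"
    and cell_card: "\<And>i. card (C i) = 2"
    and cells_disjoint: "\<And>i j. \<not> [i = j] (mod int m) \<Longrightarrow> C i \<inter> C j = {}"
    and D_disjoint: "\<And>i. C i \<inter> D = {}"
    and cover: "(\<Union>i. C i) \<union> D = UNIV"
    and parity: "\<And>x i j. x \<in> D \<Longrightarrow>
      [card (nbrs_in E x (C i)) = card (nbrs_in E x (C j))] (mod 2)"
    and dist1: "\<And>i j. j = i + 1 \<Longrightarrow> induced_edges E (C i \<union> C j) \<in>
      {{{v i 1, v j 1}, {v i 1, v j 2}}, {{v i 2, v j 1}, {v i 2, v j 2}}}"
    and dist2: "\<And>i j. j = i + 2 \<Longrightarrow> induced_edges E (C i \<union> C j) \<in>
      {{{v i 1, v j 1}, {v i 2, v j 1}}, {{v i 1, v j 2}, {v i 2, v j 2}}}"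
    and dist3: "\<And>i j. j \<in> {i + 3..i + int (m div 2)} \<Longrightarrow> induced_edges E (C i \<union> C j) \<in>
      {{}, {{v i 1, v j 1}, {v i 1, v j 2}, {v i 2, v j 1}, {v i 2, v j 2}}}"
    and shift: "\<And>i a. a \<in> {1, 2} \<Longrightarrow> \<pi> (v i a) = v (i - 1) a"
  shows "R_cospectral E (switched_graph E v C D \<pi>)"
proof -
  interpret switching m E v C D \<pi>
    by unfold_locales (fact assms)+
  show ?thesis
    by (rule R_cospectral)
qed

end
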